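(* Let $G$ be a large scale group having a basis $\{G_i\}_{i\ge1}$ for boundedly generated subgroups consisting of subgroups that are coarsely geodesic. Then the number of ends of $G$ is either infinite or at most $2$.
   Context: A large scale group is a group $G$ with a bornology $\mathcal B$ (a cover closed under subsets and finite unions) closed under inverses and products; uniformly bounded covers are those refining $\{gB\}_{g\in G}$ for some $B\in\mathcal B$; bounded sets are members of $\mathcal B$. Subgroups carry the induced bornology $\{B\in\mathcal B:B\subseteq H\}$. A subgroup is boundedly generated if it is generated by a bounded symmetric set. A basis for boundedly generated subgroups of $G$ is a sequence $\{G_i\}_{i\ge1}$ of boundedly generated subgroups such that every bounded subset of $G$ lies in some $G_i$. A large scale group $H$ is coarsely geodesic if there is a symmetric bounded set $K$ generating $H$ such that every bounded subset of $H$ is contained in some $K^n$ ($n$-fold product). A subset $A$ is coarsely clopen if $st(A,\mathcal U)\cap st(G\setminus A,\mathcal U)$ is bounded for every uniformly bounded $\mathcal U$, where $st(A,\mathcal U)$ is the union of members of $\mathcal U$ meeting $A$. An end of $G$ is a family of unbounded coarsely clopen sets maximal with respect to all finite intersections being unbounded; the number of ends is the cardinality of the set of ends. *)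

theory Defs
  imports "HOL-Algebra.Algebra"
begin

definition bornology :: "'a set \<Rightarrow> 'a set set \<Rightarrow> bool" where
  "bornology S Bn \<longleftrightarrow> Union Bn = S \<and> (\<forall>B\<in>Bn. \<forall>A. A \<subseteq> B \<longrightarrow> A \<in> Bn)
     \<and> {} \<in> Bn \<and> (\<forall>A\<in>Bn. \<forall>B\<in>Bn. A \<union> B \<in> Bn)"

definition large_scale_group :: "('a, 'b) monoid_scheme \<Rightarrow> 'a set set \<Rightarrow> bool" where
  "large_scale_group G Bn \<longleftrightarrow> group G \<and> bornology (carrier G) Bn
     \<and> (\<forall>B\<in>Bn. set_inv\<^bsub>G\<^esub> B \<in> Bn)
     \<and> (\<forall>A\<in>Bn. \<forall>B\<in>Bn. A <#>\<^bsub>G\<^esub> B \<in> Bn)"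

definition uniformly_bounded :: "('a, 'b) monoid_scheme \<Rightarrow> 'a set set \<Rightarrow> 'a set set \<Rightarrow> bool" where
  "uniformly_bounded G Bn Uc \<longleftrightarrow> Union Uc = carrier G
     \<and> (\<exists>B\<in>Bn. \<forall>U\<in>Uc. \<exists>g\<in>carrier G. U \<subseteq> g <#\<^bsub>G\<^esub> B)"

definition star :: "'a set \<Rightarrow> 'a set set \<Rightarrow> 'a set" where
  "star A Uc = \<Union>{U\<in>Uc. U \<inter> A \<noteq> {}}"

definition coarsely_clopen :: "('a, 'b) monoid_scheme \<Rightarrow> 'a set set \<Rightarrow> 'a set \<Rightarrow> bool" where
  "coarsely_clopen G Bn A \<longleftrightarrow> A \<subseteq> carrier G \<and>
     (\<forall>Uc. uniformly_bounded G Bn Uc \<longrightarrow>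
        star A Uc \<inter> star (carrier G - A) Uc \<in> Bn)"

definition finite_intersections_unbounded :: "'a set set \<Rightarrow> 'a set set \<Rightarrow> bool" where
  "finite_intersections_unbounded Bn Ef \<longleftrightarrow>
     (\<forall>Sf. Sf \<subseteq> Ef \<longrightarrow> finite Sf \<longrightarrow> Sf \<noteq> {} \<longrightarrow> Inter Sf \<notin> Bn)"

definition is_end :: "('a, 'b) monoid_scheme \<Rightarrow> 'a set set \<Rightarrow> 'a set set \<Rightarrow> bool" where
  "is_end G Bn Ef \<longleftrightarrow>
     (\<forall>A\<in>Ef. coarsely_clopen G Bn A \<and> A \<notin> Bn) \<and> finite_intersections_unbounded Bn Ef \<and>
     (\<forall>Ef'. Ef \<subseteq> Ef' \<longrightarrow> (\<forall>A\<in>Ef'. coarsely_clopen G Bn A \<and> A \<notin> Bn) \<longrightarrow>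
        finite_intersections_unbounded Bn Ef' \<longrightarrow> Ef' = Ef)"

definition ends :: "('a, 'b) monoid_scheme \<Rightarrow> 'a set set \<Rightarrow> 'a set set set" where
  "ends G Bn = {Ef. is_end G Bn Ef}"

primrec set_pow :: "('a, 'b) monoid_scheme \<Rightarrow> 'a set \<Rightarrow> nat \<Rightarrow> 'a set" where
  "set_pow G K 0 = {\<one>\<^bsub>G\<^esub>}"
| "set_pow G K (Suc n) = K <#>\<^bsub>G\<^esub> set_pow G K n"

definition induced_bornology :: "'a set set \<Rightarrow> 'a set \<Rightarrow> 'a set set" where
  "induced_bornology Bn H = {B\<in>Bn. B \<subseteq> H}"

definition boundedly_generated :: "('a, 'b) monoid_scheme \<Rightarrow> 'a set set \<Rightarrow> 'a set \<Rightarrow> bool" where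
  "boundedly_generated G Bn H \<longleftrightarrow> subgroup H G \<and>
     (\<exists>K\<in>Bn. K \<subseteq> carrier G \<and> set_inv\<^bsub>G\<^esub> K = K \<and> generate G K = H)"

definition coarsely_geodesic_subgroup :: "('a, 'b) monoid_scheme \<Rightarrow> 'a set set \<Rightarrow> 'a set \<Rightarrow> bool" where
  "coarsely_geodesic_subgroup G Bn H \<longleftrightarrow>
     (\<exists>K\<in>induced_bornology Bn H. set_inv\<^bsub>G\<^esub> K = K \<and> generate G K = H \<and>
        (\<forall>B\<in>induced_bornology Bn H. \<exists>n\<ge>1. B \<subseteq> set_pow G K n))"

definition basis_bg_subgroups :: "('a, 'b) monoid_scheme \<Rightarrow> 'a set set \<Rightarrow> (nat \<Rightarrow> 'a set) \<Rightarrow> bool" where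
  "basis_bg_subgroups G Bn Gs \<longleftrightarrow>
     (\<forall>i\<ge>1. boundedly_generated G Bn (Gs i)) \<and>
     (\<forall>B\<in>Bn. \<exists>i\<ge>1. B \<subseteq> Gs i)"

end

theory Submission
  imports Defs
begin

text \<open>
  An end is an ultrafilter of coarsely clopen sets modulo bounded sets. If there are finitely many
  ends and at least three of them, choose a partition \<open>P\<close> of \<open>G\<close> into unbounded
  coarsely clopen sets of maximal cardinality \<open>N \<ge> 3\<close>; by maximality its members are atoms
  modulo bounded sets.

  If \<open>G\<close> is one of the coarsely geodesic \<open>G\<^sub>i\<close>, all points where \<open>P\<close> changes within one
  generator lie in a ball \<open>C\<close>. For \<open>g\<close> far away the connected set \<open>gC\<close> lies in a single
  \<open>A\<^sub>p \<in> P\<close>, and \<open>C\<close> lies in a single \<open>gA\<^sub>q\<close>. A set \<open>A \<inter> gB\<close> with \<open>A \<in> P\<close>,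
  \<open>B \<in> P\<close>, \<open>A \<noteq> A\<^sub>p\<close>, \<open>B \<noteq> A\<^sub>q\<close> avoids both balls, so it is closed under the generators
  and hence empty. The \<open>2N - 2 > N\<close> sets \<open>A\<close> and \<open>gB\<close> are therefore disjoint, against maximality.

  If no boundedly generated subgroup is all of \<open>G\<close>, a far coset of such a subgroup \<open>H\<close>
  misses the boundary of \<open>P\<close>, so \<open>H\<close> lies in a single member of \<open>P\<close> up to a bounded set.
  If some \<open>H\<close> is unbounded, this member is the same for all larger \<open>H\<close>, and \<open>G\<close> itself is
  almost contained in it. If all \<open>H\<close> are bounded, \<open>G\<close> is a strictly increasing union of
  bounded subgroups \<open>H\<^sub>k\<close>, and arbitrary unions of the layers \<open>H\<^sub>k\<^sub>+\<^sub>1 - H\<^sub>k\<close> are coarsely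
  clopen, which gives families of any finite size.
\<close>

text \<open>Otherwise \<open>g <# A\<close> could also be read as multiset inclusion.\<close>
no_notation subset_mset (infix \<open><#\<close> 50)

section \<open>Bounded sets and left translates\<close>

locale ls_group = group G for G :: "('a, 'b) monoid_scheme" (structure) +
  fixes Bn :: "'a set set"
  assumes large_scale: "large_scale_group G Bn"
begin

lemma bounded_subset: "B \<in> Bn \<Longrightarrow> A \<subseteq> B \<Longrightarrow> A \<in> Bn"
  using large_scale unfolding large_scale_group_def bornology_def by blast

lemma bounded_Un: "A \<in> Bn \<Longrightarrow> B \<in> Bn \<Longrightarrow> A \<union> B \<in> Bn"
  using large_scale unfolding large_scale_group_def bornology_def by blast

lemma bounded_empty: "{} \<in> Bn"
  using large_scale unfolding large_scale_group_def bornology_def by blast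

lemma bounded_carrier: "B \<in> Bn \<Longrightarrow> B \<subseteq> carrier G"
  using large_scale unfolding large_scale_group_def bornology_def by blast

lemma bounded_inv: "B \<in> Bn \<Longrightarrow> set_inv B \<in> Bn"
  using large_scale unfolding large_scale_group_def by blast

lemma bounded_mult: "A \<in> Bn \<Longrightarrow> B \<in> Bn \<Longrightarrow> A <#> B \<in> Bn"
  using large_scale unfolding large_scale_group_def by blast

lemma bounded_singleton:
  assumes "x \<in> carrier G"
  shows "{x} \<in> Bn"
proof -
  have "\<Union>Bn = carrier G"
    using large_scale unfolding large_scale_group_def bornology_def by simp
  with assms obtain B where "B \<in> Bn" "x \<in> B" by blast
  then show ?thesis using bounded_subset by simp
qed

lemma bounded_insert: "x \<in> carrier G \<Longrightarrow> B \<in> Bn \<Longrightarrow> insert x B \<in> Bn"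
  using bounded_Un[OF bounded_singleton, of x B] by simp

lemma bounded_UN: "finite I \<Longrightarrow> (\<And>i. i \<in> I \<Longrightarrow> f i \<in> Bn) \<Longrightarrow> (\<Union>i\<in>I. f i) \<in> Bn"
  by (induction rule: finite_induct) (simp_all add: bounded_empty bounded_Un)

lemma bounded_translate: "g \<in> carrier G \<Longrightarrow> B \<in> Bn \<Longrightarrow> g <# B \<in> Bn"
  using bounded_mult[OF bounded_singleton, of g B] by (simp add: l_coset_eq_set_mult)

lemma mem_translate_iff:
  assumes "g \<in> carrier G" "A \<subseteq> carrier G" "x \<in> carrier G"
  shows "x \<in> g <# A \<longleftrightarrow> inv g \<otimes> x \<in> A"
proof
  assume "x \<in> g <# A"
  then obtain a where "a \<in> A" "x = g \<otimes> a" by (auto simp: l_coset_def)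
  then show "inv g \<otimes> x \<in> A"
    using assms by (metis inv_closed inv_solve_left subsetD)
next
  assume "inv g \<otimes> x \<in> A"
  moreover have "x = g \<otimes> (inv g \<otimes> x)"
    using assms by (simp add: m_assoc[symmetric])
  ultimately show "x \<in> g <# A" by (auto simp: l_coset_def)
qed

lemma translate_inverse:
  assumes "g \<in> carrier G" "A \<subseteq> carrier G"
  shows "inv g <# (g <# A) = A"
  using assms by (simp add: lcos_m_assoc lcos_mult_one)

lemma bounded_translate_iff:
  assumes "g \<in> carrier G" "A \<subseteq> carrier G"
  shows "g <# A \<in> Bn \<longleftrightarrow> A \<in> Bn"
  using bounded_translate[of g A] bounded_translate[of "inv g" "g <# A"]
    translate_inverse[OF assms] inv_closed[OF assms(1)] assms(1) by metis

section \<open>Coarsely clopen sets through their boundaries\<close>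

definition bd :: "'a set \<Rightarrow> 'a set \<Rightarrow> 'a set" where
  "bd B A = {a\<in>A. \<exists>b\<in>B. a \<otimes> b \<notin> A}"

text \<open>\<open>bd B A\<close> is the inner boundary of \<open>A\<close> in the graph with edges
  from \<open>x\<close> to \<open>x \<otimes> b\<close>, \<open>b \<in> B\<close>. Stars and
  boundaries control each other because two points of one translate of \<open>B\<close> differ by a
  right factor from \<open>set_inv B <#> B\<close>.\<close>

lemma clopen_iff_bd:
  "coarsely_clopen G Bn A \<longleftrightarrow> A \<subseteq> carrier G \<and> (\<forall>B\<in>Bn. bd B A \<in> Bn)"
proof (intro iffI conjI ballI)
  assume A: "coarsely_clopen G Bn A"
  then show sub: "A \<subseteq> carrier G" by (simp add: coarsely_clopen_def)
  fix B assume B: "B \<in> Bn"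
  \<comment> \<open>With \<open>\<one>\<close> added, each \<open>g\<close> lies in its own
    translate, so \<open>Uc\<close> covers the group and a step by \<open>B\<close> from
    \<open>g\<close> stays inside one member.\<close>
  define Uc where "Uc = (\<lambda>g. g <# insert \<one> B) ` carrier G"
  have iB: "insert \<one> B \<in> Bn" using B by (simp add: bounded_insert)
  have mem: "g \<in> g <# insert \<one> B" if "g \<in> carrier G" for g
    using that by (auto simp: l_coset_def)
  have "uniformly_bounded G Bn Uc"
    unfolding uniformly_bounded_def
  proof
    show "\<Union>Uc = carrier G"
      using mem l_coset_subset_G[OF bounded_carrier[OF iB]] by (auto simp: Uc_def)
    show "\<exists>B\<in>Bn. \<forall>U\<in>Uc. \<exists>g\<in>carrier G. U \<subseteq> g <# B"
      using iB by (auto simp: Uc_def)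
  qed
  then have "star A Uc \<inter> star (carrier G - A) Uc \<in> Bn"
    using A by (simp add: coarsely_clopen_def)
  moreover have "bd B A \<subseteq> star A Uc \<inter> star (carrier G - A) Uc"
  proof
    fix a assume "a \<in> bd B A"
    then obtain b where ab: "a \<in> A" "b \<in> B" "a \<otimes> b \<notin> A" by (auto simp: bd_def)
    have c: "a \<in> carrier G" "b \<in> carrier G"
      using ab sub bounded_carrier[OF B] by auto
    have "a <# insert \<one> B \<in> Uc" "a \<in> a <# insert \<one> B" "a \<otimes> b \<in> a <# insert \<one> B"
      using c mem ab by (auto simp: Uc_def l_coset_def)
    moreover have "a \<otimes> b \<in> carrier G - A" using c ab by auto
    ultimately show "a \<in> star A Uc \<inter> star (carrier G - A) Uc"
      using ab unfolding star_def by blast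
  qed
  ultimately show "bd B A \<in> Bn" by (rule bounded_subset)
next
  assume A: "A \<subseteq> carrier G \<and> (\<forall>B\<in>Bn. bd B A \<in> Bn)"
  show "coarsely_clopen G Bn A"
    unfolding coarsely_clopen_def
  proof (intro conjI allI impI)
    show "A \<subseteq> carrier G" using A by simp
    fix Uc assume "uniformly_bounded G Bn Uc"
    then obtain B where B: "B \<in> Bn"
      and U: "\<And>U. U \<in> Uc \<Longrightarrow> \<exists>g\<in>carrier G. U \<subseteq> g <# B"
      by (auto simp: uniformly_bounded_def)
    define C where "C = set_inv B <#> B"
    have C: "C \<in> Bn" unfolding C_def using B by (intro bounded_mult bounded_inv)
    have near: "\<exists>c\<in>C. y = x \<otimes> c" "x \<in> carrier G" "y \<in> carrier G"
      if xy: "U \<in> Uc" "x \<in> U" "y \<in> U" for U x y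
    proof -
      from U[OF xy(1)] xy obtain g b d where g: "g \<in> carrier G" "b \<in> B" "d \<in> B"
        "x = g \<otimes> b" "y = g \<otimes> d"
        unfolding l_coset_def by blast
      have bd: "b \<in> carrier G" "d \<in> carrier G" using g bounded_carrier[OF B] by auto
      have cancel: "b \<otimes> (inv b \<otimes> d) = d"
        using bd by (simp add: m_assoc[symmetric])
      have "y = x \<otimes> (inv b \<otimes> d)"
        using g bd cancel by (simp add: m_assoc)
      moreover have "inv b \<otimes> d \<in> C"
        using g by (auto simp: C_def set_mult_def SET_INV_def)
      ultimately show "\<exists>c\<in>C. y = x \<otimes> c" by blast
      show "x \<in> carrier G" "y \<in> carrier G" using g bd by auto
    qed
    \<comment> \<open>A point \<open>x\<close> of both stars is a \<open>C\<close>-step away from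
      some \<open>a\<close> in \<open>A\<close> and some \<open>c\<close> outside. If
      \<open>x\<close> is in \<open>A\<close>, it is a boundary point itself; otherwise
      \<open>a\<close> is one.\<close>
    have "star A Uc \<inter> star (carrier G - A) Uc \<subseteq> (bd C A <#> C) \<union> bd C A"
    proof
      fix x assume "x \<in> star A Uc \<inter> star (carrier G - A) Uc"
      then obtain U V a c where *: "U \<in> Uc" "x \<in> U" "a \<in> U" "a \<in> A"
        "V \<in> Uc" "x \<in> V" "c \<in> V" "c \<notin> A"
        by (auto simp: star_def)
      obtain k l where "k \<in> C" "x = a \<otimes> k" "l \<in> C" "c = x \<otimes> l"
        using near(1)[of U a x] near(1)[of V x c] * by blast
      then show "x \<in> (bd C A <#> C) \<union> bd C A"
        using * by (cases "x \<in> A") (auto simp: bd_def set_mult_def)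
    qed
    then show "star A Uc \<inter> star (carrier G - A) Uc \<in> Bn"
      by (rule bounded_subset[rotated]) (use A C in \<open>auto intro!: bounded_Un bounded_mult\<close>)
  qed
qed

abbreviation clopen :: "'a set \<Rightarrow> bool" where
  "clopen \<equiv> coarsely_clopen G Bn"

lemma clopen_sub: "clopen A \<Longrightarrow> A \<subseteq> carrier G"
  by (simp add: coarsely_clopen_def)

lemma clopen_bd: "clopen A \<Longrightarrow> B \<in> Bn \<Longrightarrow> bd B A \<in> Bn"
  by (simp add: clopen_iff_bd)

lemma clopen_compl: "clopen A \<Longrightarrow> clopen (carrier G - A)"
proof -
  have "carrier G - (carrier G - A) = A" if "A \<subseteq> carrier G" using that by blast
  then show "clopen A \<Longrightarrow> clopen (carrier G - A)"
    by (auto simp: coarsely_clopen_def Int_commute)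
qed

lemma clopen_Int: "clopen A \<Longrightarrow> clopen B \<Longrightarrow> clopen (A \<inter> B)"
  unfolding clopen_iff_bd
proof (intro conjI ballI)
  assume *: "A \<subseteq> carrier G \<and> (\<forall>C\<in>Bn. bd C A \<in> Bn)" "B \<subseteq> carrier G \<and> (\<forall>C\<in>Bn. bd C B \<in> Bn)"
  then show "A \<inter> B \<subseteq> carrier G" by blast
  fix C assume "C \<in> Bn"
  then have "bd C A \<union> bd C B \<in> Bn" using * by (simp add: bounded_Un)
  then show "bd C (A \<inter> B) \<in> Bn" by (rule bounded_subset) (auto simp: bd_def)
qed

lemma clopen_Diff: "clopen A \<Longrightarrow> clopen B \<Longrightarrow> clopen (A - B)"
proof -
  assume "clopen A" "clopen B"
  then have "clopen (A \<inter> (carrier G - B))" by (intro clopen_Int clopen_compl)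
  moreover have "A \<inter> (carrier G - B) = A - B" using clopen_sub[OF \<open>clopen A\<close>] by blast
  ultimately show ?thesis by simp
qed

lemma clopen_Un:
  assumes "clopen A" "clopen B"
  shows "clopen (A \<union> B)"
proof -
  have "clopen (carrier G - ((carrier G - A) \<inter> (carrier G - B)))"
    using assms by (intro clopen_Int clopen_compl)
  moreover have "carrier G - ((carrier G - A) \<inter> (carrier G - B)) = A \<union> B"
    using clopen_sub[OF assms(1)] clopen_sub[OF assms(2)] by blast
  ultimately show ?thesis by simp
qed

lemma clopen_carrier: "clopen (carrier G)"
  unfolding clopen_iff_bd
proof (intro conjI ballI)
  fix B assume "B \<in> Bn"
  then have "bd B (carrier G) = {}"
    using bounded_carrier by (auto simp: bd_def)
  then show "bd B (carrier G) \<in> Bn" by (simp add: bounded_empty)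
qed simp

lemma clopen_Union: "finite P \<Longrightarrow> (\<And>A. A \<in> P \<Longrightarrow> clopen A) \<Longrightarrow> clopen (\<Union>P)"
proof (induction rule: finite_induct)
  case empty
  show ?case using clopen_compl[OF clopen_carrier] by simp
qed (simp add: clopen_Un)

lemma translate_sub: "g \<in> carrier G \<Longrightarrow> A \<subseteq> carrier G \<Longrightarrow> g <# A \<subseteq> carrier G"
  by (rule l_coset_subset_G[rotated])

text \<open>Left translation commutes with the right multiplications that define
  \<open>bd\<close>.\<close>

lemma bd_translate:
  assumes "g \<in> carrier G" "A \<subseteq> carrier G" "B \<subseteq> carrier G"
  shows "bd B (g <# A) \<subseteq> g <# bd B A"
proof
  fix y assume "y \<in> bd B (g <# A)"
  then obtain a b where *: "a \<in> A" "y = g \<otimes> a" "b \<in> B" "y \<otimes> b \<notin> g <# A"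
    by (auto simp: bd_def l_coset_def)
  have "a \<otimes> b \<notin> A"
  proof
    assume "a \<otimes> b \<in> A"
    then have "g \<otimes> (a \<otimes> b) \<in> g <# A" by (auto simp: l_coset_def)
    moreover have "g \<otimes> (a \<otimes> b) = y \<otimes> b"
      using * assms by (simp add: m_assoc subset_iff)
    ultimately show False using * by simp
  qed
  then show "y \<in> g <# bd B A" using * by (auto simp: bd_def l_coset_def)
qed

lemma clopen_translate:
  assumes "g \<in> carrier G" "clopen A"
  shows "clopen (g <# A)"
  unfolding clopen_iff_bd
proof (intro conjI ballI)
  show "g <# A \<subseteq> carrier G" using assms clopen_sub translate_sub by simp
  fix B assume "B \<in> Bn"
  then have "g <# bd B A \<in> Bn"
    by (rule bounded_translate[OF assms(1) clopen_bd[OF assms(2)]])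
  then show "bd B (g <# A) \<in> Bn"
    using bd_translate[OF assms(1) clopen_sub[OF assms(2)] bounded_carrier[OF \<open>B \<in> Bn\<close>]]
    by (rule bounded_subset)
qed

section \<open>Ends as ultrafilters of large sets\<close>

definition large :: "'a set \<Rightarrow> bool" where
  "large A \<longleftrightarrow> clopen A \<and> A \<notin> Bn"

lemma is_end_iff:
  "is_end G Bn E \<longleftrightarrow> (\<forall>A\<in>E. large A) \<and> finite_intersections_unbounded Bn E \<and>
    (\<forall>E'. E \<subseteq> E' \<longrightarrow> (\<forall>A\<in>E'. large A) \<longrightarrow> finite_intersections_unbounded Bn E' \<longrightarrow> E' = E)"
  by (simp add: is_end_def large_def)

text \<open>Zorn's lemma applies because a finite subfamily of the union of a chain already lies in
  one member of the chain.\<close>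

lemma end_exists:
  assumes "large A"
  obtains E where "E \<in> ends G Bn" "A \<in> E"
proof -
  define F where "F = {E. A \<in> E \<and> (\<forall>B\<in>E. large B) \<and> finite_intersections_unbounded Bn E}"
  have "{A} \<in> F"
  proof -
    have "finite_intersections_unbounded Bn {A}"
      unfolding finite_intersections_unbounded_def
    proof (intro allI impI)
      fix S assume "S \<subseteq> {A}" "S \<noteq> {}"
      then have "S = {A}" by blast
      then show "\<Inter>S \<notin> Bn" using assms by (simp add: large_def)
    qed
    then show ?thesis using assms by (simp add: F_def)
  qed
  moreover have "\<Union>C \<in> F" if C: "C \<noteq> {}" "subset.chain F C" for C
  proof -
    have CF: "C \<subseteq> F" using C by (simp add: subset.chain_def)
    have "\<Inter>S \<notin> Bn" if S: "S \<subseteq> \<Union>C" "finite S" "S \<noteq> {}" for S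
    proof -
      obtain E where "E \<in> C" "S \<subseteq> E"
        using finite_subset_Union_chain[OF S(2,1) C] by blast
      then have "E \<in> F" using CF by blast
      then show ?thesis
        using S \<open>S \<subseteq> E\<close> by (simp add: F_def finite_intersections_unbounded_def)
    qed
    then have "finite_intersections_unbounded Bn (\<Union>C)"
      unfolding finite_intersections_unbounded_def by blast
    then show ?thesis
      using CF C(1) unfolding F_def by blast
  qed
  ultimately obtain M where M: "M \<in> F" "\<And>V. V \<in> F \<Longrightarrow> M \<subseteq> V \<Longrightarrow> V = M"
    using subset_Zorn_nonempty[of F] by blast
  have "is_end G Bn M"
    unfolding is_end_iff
  proof (intro conjI allI impI)
    show "\<forall>A\<in>M. large A" "finite_intersections_unbounded Bn M"
      using M(1) by (auto simp: F_def)
    fix E' assume "M \<subseteq> E'" "\<forall>A\<in>E'. large A" "finite_intersections_unbounded Bn E'"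
    then show "E' = M" using M by (auto simp: F_def)
  qed
  then show ?thesis using that M(1) by (auto simp: ends_def F_def)
qed

lemma end_Int_unbounded:
  assumes "E \<in> ends G Bn" "A \<in> E" "B \<in> E"
  shows "A \<inter> B \<notin> Bn"
proof -
  have "finite_intersections_unbounded Bn E"
    using assms(1) by (simp add: ends_def is_end_def)
  then have "\<Inter>{A, B} \<notin> Bn"
    using assms(2,3) unfolding finite_intersections_unbounded_def
    by (metis empty_subsetI finite.emptyI finite.insertI insert_not_empty insert_subset)
  then show ?thesis by simp
qed

lemma end_large: "E \<in> ends G Bn \<Longrightarrow> A \<in> E \<Longrightarrow> large A"
  by (simp add: ends_def is_end_iff)

text \<open>By maximality, adding \<open>A\<close> destroys the finite intersection property;
  \<open>S\<close> is the offending subfamily without \<open>A\<close>.\<close>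

lemma not_in_end:
  assumes E: "E \<in> ends G Bn" and A: "large A" "A \<notin> E"
  obtains S where "S \<subseteq> E" "finite S" "A \<inter> \<Inter>S \<in> Bn"
proof -
  have max: "insert A E = E" if "finite_intersections_unbounded Bn (insert A E)"
    using E A(1) that unfolding ends_def is_end_iff by blast
  then obtain T where T: "T \<subseteq> insert A E" "finite T" "T \<noteq> {}" "\<Inter>T \<in> Bn"
    using A(2) unfolding finite_intersections_unbounded_def by blast
  show ?thesis
  proof
    show "T - {A} \<subseteq> E" "finite (T - {A})" using T by auto
    show "A \<inter> \<Inter>(T - {A}) \<in> Bn" using T(4) by (rule bounded_subset) auto
  qed
qed

text \<open>The ultrafilter property: if both sets were missing, each would meet some finite
  intersection from \<open>E\<close> in a bounded set, and the two subfamilies together would have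
  bounded intersection. \<open>E \<noteq> {}\<close> excludes a bounded \<open>G\<close>, whose only
  end is the empty family.\<close>

lemma end_compl:
  assumes E: "E \<in> ends G Bn" "E \<noteq> {}" and A: "clopen A" "A \<notin> E"
  shows "carrier G - A \<in> E"
proof -
  have fip: "\<Inter>S \<notin> Bn" if "S \<subseteq> E" "finite S" "S \<noteq> {}" for S
    using that E(1) by (simp add: ends_def is_end_def finite_intersections_unbounded_def)
  have *: "\<exists>S. S \<subseteq> E \<and> finite S \<and> S \<noteq> {} \<and> V \<inter> \<Inter>S \<in> Bn" if V: "clopen V" "V \<notin> E" for V
  proof (cases "V \<in> Bn")
    \<comment> \<open>\<open>not_in_end\<close> speaks of large sets only; for bounded
      \<open>V\<close> any single member of \<open>E\<close> will do.\<close>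
    case True
    obtain B where "B \<in> E" using E by blast
    moreover have "V \<inter> \<Inter>{B} \<in> Bn" using True by (rule bounded_subset) auto
    ultimately show ?thesis by blast
  next
    case False
    then have lX: "large V" using V by (simp add: large_def)
    obtain S where S: "S \<subseteq> E" "finite S" "V \<inter> \<Inter>S \<in> Bn" using not_in_end[OF E(1) lX V(2)] .
    have "S \<noteq> {}" using S(3) False by auto
    then show ?thesis using S by blast
  qed
  show ?thesis
  proof (rule ccontr)
    assume "carrier G - A \<notin> E"
    then obtain S where S: "S \<subseteq> E" "finite S" "S \<noteq> {}" "(carrier G - A) \<inter> \<Inter>S \<in> Bn"
      using *[OF clopen_compl[OF A(1)]] by blast
    obtain T where T: "T \<subseteq> E" "finite T" "T \<noteq> {}" "A \<inter> \<Inter>T \<in> Bn"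
      using *[OF A] by blast
    have sub: "\<Inter>S \<subseteq> carrier G"
      using S(1,3) end_large[OF E(1)] clopen_sub unfolding large_def by blast
    have "((carrier G - A) \<inter> \<Inter>S) \<union> (A \<inter> \<Inter>T) \<in> Bn" using S T by (intro bounded_Un)
    then have "\<Inter>(S \<union> T) \<in> Bn" by (rule bounded_subset) (use sub in auto)
    then show False using fip[of "S \<union> T"] S T by simp
  qed
qed

lemma end_Int:
  assumes E: "E \<in> ends G Bn" and AB: "A \<in> E" "B \<in> E"
  shows "A \<inter> B \<in> E"
proof (rule ccontr)
  assume n: "A \<inter> B \<notin> E"
  have l: "large (A \<inter> B)"
    using end_Int_unbounded[OF E AB] end_large[OF E] AB clopen_Int by (simp add: large_def)
  obtain S where S: "S \<subseteq> E" "finite S" "A \<inter> B \<inter> \<Inter>S \<in> Bn" using not_in_end[OF E l n] .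
  have "\<Inter>(insert A (insert B S)) \<in> Bn" using S(3) by (simp add: Int_assoc)
  moreover have "insert A (insert B S) \<subseteq> E" "finite (insert A (insert B S))"
    "insert A (insert B S) \<noteq> {}" using S AB by auto
  ultimately show False
    using E unfolding ends_def is_end_def finite_intersections_unbounded_def by blast
qed

lemma ends_not_subset:
  assumes "E \<in> ends G Bn" "F \<in> ends G Bn" "E \<noteq> F"
  obtains A where "A \<in> E" "A \<notin> F"
proof -
  have "\<not> E \<subseteq> F"
  proof
    assume "E \<subseteq> F"
    moreover have "\<forall>A\<in>F. large A" "finite_intersections_unbounded Bn F"
      using assms(2) by (simp_all add: ends_def is_end_iff)
    ultimately have "F = E"
      using assms(1) by (simp add: ends_def is_end_iff)
    then show False using assms(3) by simp
  qed
  then show ?thesis using that by blast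
qed

section \<open>Disjoint families of large sets\<close>

definition family :: "'a set set \<Rightarrow> bool" where
  "family P \<longleftrightarrow> finite P \<and> pairwise disjnt P \<and> (\<forall>A\<in>P. large A)"

text \<open>Each member lies in some end, and disjoint members cannot share one, since two sets of
  an end have unbounded intersection.\<close>

lemma family_card_le:
  assumes "finite (ends G Bn)" "family P"
  shows "card P \<le> card (ends G Bn)"
proof -
  define f where "f A = (SOME E. E \<in> ends G Bn \<and> A \<in> E)" for A
  have f: "f A \<in> ends G Bn" "A \<in> f A" if "A \<in> P" for A
  proof -
    have "large A" using that assms(2) by (simp add: family_def)
    then obtain E where "E \<in> ends G Bn" "A \<in> E" by (rule end_exists)
    then have "\<exists>E. E \<in> ends G Bn \<and> A \<in> E" by blast
    from someI_ex[OF this] show "f A \<in> ends G Bn" "A \<in> f A" by (auto simp: f_def)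
  qed
  have "inj_on f P"
  proof (rule inj_onI, rule ccontr)
    fix A B assume *: "A \<in> P" "B \<in> P" "f A = f B" "A \<noteq> B"
    then have "A \<inter> B \<notin> Bn" using f end_Int_unbounded by metis
    moreover have "A \<inter> B = {}"
      using * assms(2) by (auto simp: family_def pairwise_def disjnt_def)
    ultimately show False by (simp add: bounded_empty)
  qed
  then show ?thesis using f assms(1) by (intro card_inj_on_le) auto
qed

text \<open>\<open>V\<close>, \<open>Y\<close> and \<open>Z\<close> separate the three pairs of
  ends. Intersections of them and their complements lie in \<open>E1\<close>, \<open>E2\<close>,
  \<open>E3\<close> and are disjoint.\<close>

lemma family_three:
  assumes "E1 \<in> ends G Bn" "E2 \<in> ends G Bn" "E3 \<in> ends G Bn"
    and "E1 \<noteq> E2" "E1 \<noteq> E3" "E2 \<noteq> E3"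
  obtains P where "family P" "card P = 3"
proof -
  obtain V where V: "V \<in> E1" "V \<notin> E2" using ends_not_subset assms by metis
  obtain Y where Y: "Y \<in> E1" "Y \<notin> E3" using ends_not_subset assms by metis
  obtain Z where Z: "Z \<in> E2" "Z \<notin> E3" using ends_not_subset assms by metis
  \<comment> \<open>\<open>W\<close> only witnesses that \<open>E3\<close> is nonempty, as
    \<open>end_compl\<close> demands.\<close>
  obtain W where W: "W \<in> E3" using ends_not_subset assms by metis
  have cl: "clopen V" "clopen Y" "clopen Z"
    using V Y Z end_large assms by (auto simp: large_def)
  have "carrier G - V \<in> E2" "carrier G - Y \<in> E3" "carrier G - Z \<in> E3"
    using end_compl[of E2] end_compl[of E3] assms V Y Z W cl by blast+
  then have "V \<inter> Y \<in> E1" "Z \<inter> (carrier G - V) \<in> E2"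
    "(carrier G - Y) \<inter> (carrier G - Z) \<in> E3"
    using end_Int assms V Y Z by simp_all
  then have l: "large (V \<inter> Y)" "large (Z \<inter> (carrier G - V))"
    "large ((carrier G - Y) \<inter> (carrier G - Z))"
    using end_large assms by simp_all
  then have ne: "V \<inter> Y \<noteq> {}" "Z \<inter> (carrier G - V) \<noteq> {}"
    using bounded_empty unfolding large_def by auto
  let ?P = "{V \<inter> Y, Z \<inter> (carrier G - V), (carrier G - Y) \<inter> (carrier G - Z)}"
  have d: "V \<inter> Y \<noteq> Z \<inter> (carrier G - V)" "V \<inter> Y \<noteq> (carrier G - Y) \<inter> (carrier G - Z)"
    "Z \<inter> (carrier G - V) \<noteq> (carrier G - Y) \<inter> (carrier G - Z)"
    using ne by blast+
  have "family ?P"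
    unfolding family_def by (auto simp: pairwise_def disjnt_def l)
  moreover have "card ?P = 3" using d by simp
  ultimately show ?thesis using that by blast
qed

text \<open>One member absorbs everything outside the others. Maximal cardinality can thus be sought
  among all disjoint families, and a partition made afterwards.\<close>

lemma family_to_cover:
  assumes P: "family P" "P \<noteq> {}"
  obtains Q where "family Q" "\<Union>Q = carrier G" "card Q = card P"
proof -
  obtain A where A: "A \<in> P" using P by blast
  define A' where "A' = carrier G - \<Union>(P - {A})"
  have fin: "finite P" and cl: "\<And>B. B \<in> P \<Longrightarrow> clopen B"
    and dj: "\<And>B C. B \<in> P \<Longrightarrow> C \<in> P \<Longrightarrow> B \<noteq> C \<Longrightarrow> B \<inter> C = {}"
    using P(1) by (auto simp: family_def large_def pairwise_def disjnt_def)
  have sub: "A \<subseteq> A'"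
    using clopen_sub[OF cl[OF A]] dj[OF A] by (auto simp: A'_def)
  have unb: "A \<notin> Bn" using A P(1) by (simp add: family_def large_def)
  have "clopen A'"
    unfolding A'_def using fin cl by (intro clopen_compl clopen_Union) auto
  moreover have "A' \<notin> Bn" using sub unb bounded_subset by blast
  ultimately have l: "large A'" by (simp add: large_def)
  have dj': "A' \<inter> B = {}" if "B \<in> P - {A}" for B using that by (auto simp: A'_def)
  have "A' \<noteq> {}" using l bounded_empty by (auto simp: large_def)
  then have nin: "A' \<notin> P - {A}" using dj' by blast
  show ?thesis
  proof
    show "family (insert A' (P - {A}))"
      using P(1) l dj' by (auto simp: family_def pairwise_insert disjnt_def Int_commute
          intro: pairwise_subset)
    show "card (insert A' (P - {A})) = card P"
      using nin fin A by (simp add: card_Suc_Diff1 card_Diff_singleton card_gt_0_iff)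
        (metis Suc_pred card_gt_0_iff empty_iff)
    show "\<Union>(insert A' (P - {A})) = carrier G"
      using cl clopen_sub by (auto simp: A'_def)
  qed
qed

section \<open>Connectedness along generators, cosets, and powers of generating sets\<close>

lemma generate_closed:
  assumes W: "W \<subseteq> carrier G" and K: "K \<subseteq> carrier G" "set_inv K = K"
    and step: "\<And>y k. y \<in> W \<Longrightarrow> k \<in> K \<Longrightarrow> y \<otimes> k \<in> W"
    and h: "h \<in> generate G K" and y: "y \<in> W"
  shows "y \<otimes> h \<in> W"
  using h y
proof (induction arbitrary: y rule: generate.induct)
  case one
  then show ?case using W by auto
next
  case (incl h)
  then show ?case using step by simp
next
  case (inv h)
  then have "inv h \<in> set_inv K" by (auto simp: SET_INV_def)
  then show ?case using step inv K(2) by simp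
next
  case (eng h1 h2)
  have "y \<otimes> h1 \<otimes> h2 \<in> W" using eng by simp
  moreover have "h1 \<in> carrier G" "h2 \<in> carrier G"
    using eng.hyps generate_in_carrier[OF K(1)] by simp_all
  moreover have "y \<in> carrier G" using eng.prems W by blast
  ultimately show ?case by (simp add: m_assoc)
qed

text \<open>If \<open>x \<otimes> h\<close> were in \<open>H'\<close> with \<open>h\<close> in
  \<open>H'\<close>, so would be \<open>x\<close>. This keeps far cosets off a boundary that
  \<open>H'\<close> contains.\<close>

lemma coset_off_subgroup:
  assumes "subgroup H' G" "H \<subseteq> H'" "x \<in> carrier G" "x \<notin> H'" "S \<subseteq> H'"
  shows "(x <# H) \<inter> S = {}"
proof (rule ccontr)
  assume "(x <# H) \<inter> S \<noteq> {}"
  then obtain h where h: "h \<in> H" "x \<otimes> h \<in> S" by (auto simp: l_coset_def)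
  then have hH: "h \<in> H'" "x \<otimes> h \<in> H'" using assms by auto
  then have "x \<otimes> h \<otimes> inv h \<in> H'"
    using assms(1) by (simp add: subgroup.m_closed subgroup.m_inv_closed)
  moreover have "x \<otimes> h \<otimes> inv h = x"
    using assms(3) subgroup.mem_carrier[OF assms(1) hH(1)] by (simp add: m_assoc)
  ultimately show False using assms(4) by simp
qed

lemma set_pow_bounded: "K \<in> Bn \<Longrightarrow> set_pow G K n \<in> Bn"
  by (induction n) (simp_all add: bounded_singleton bounded_mult)

lemma one_in_set_pow: "\<one> \<in> K \<Longrightarrow> \<one> \<in> set_pow G K n"
proof (induction n)
  case (Suc n)
  then have "\<one> \<otimes> \<one> \<in> K <#> set_pow G K n" unfolding set_mult_def by blast
  then show ?case by simp
qed simp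

lemma set_pow_mono: "K \<subseteq> L \<Longrightarrow> set_pow G K n \<subseteq> set_pow G L n"
  by (induction n) (simp_all add: mono_set_mult)

end

section \<open>Maximal partitions and their atoms\<close>

locale max_partition = ls_group +
  fixes P
  assumes family: "family P"
    and cover: "\<Union>P = carrier G"
    and max: "family Q \<Longrightarrow> card Q \<le> card P"
    and two: "2 \<le> card P"
begin

lemma fin: "finite P"
  using family by (simp add: family_def)

lemma part_disjoint: "A \<in> P \<Longrightarrow> B \<in> P \<Longrightarrow> A \<noteq> B \<Longrightarrow> A \<inter> B = {}"
  using family by (simp add: family_def pairwise_def disjnt_def)

lemma part_large: "A \<in> P \<Longrightarrow> large A"
  using family by (simp add: family_def)

lemma part_clopen: "A \<in> P \<Longrightarrow> clopen A"
  using part_large by (simp add: large_def)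

lemma part_unbounded: "A \<in> P \<Longrightarrow> A \<notin> Bn"
  using part_large by (simp add: large_def)

lemma part_nonempty: "A \<in> P \<Longrightarrow> A \<noteq> {}"
  using part_unbounded bounded_empty by blast

lemma part_sub: "A \<in> P \<Longrightarrow> A \<subseteq> carrier G"
  using cover by blast

lemma in_part:
  assumes "x \<in> carrier G"
  obtains A where "A \<in> P" "x \<in> A"
  using assms cover by blast

lemma other_part:
  obtains B where "B \<in> P" "B \<noteq> A"
proof -
  have "\<not> P \<subseteq> {A}"
  proof
    assume "P \<subseteq> {A}"
    then have "card P \<le> card {A}" by (rule card_mono[rotated]) simp
    then show False using two by simp
  qed
  then show ?thesis using that by blast
qed

lemma carrier_unbounded: "carrier G \<notin> Bn"
  using other_part part_unbounded part_sub bounded_subset by metis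

lemma unbounded_meets_part:
  assumes "S \<subseteq> carrier G" "S \<notin> Bn"
  obtains A where "A \<in> P" "S \<inter> A \<notin> Bn"
proof -
  have "S = (\<Union>A\<in>P. S \<inter> A)" using assms(1) cover by blast
  then have "\<not> (\<forall>A\<in>P. S \<inter> A \<in> Bn)" using assms(2) bounded_UN[OF fin, of "\<lambda>A. S \<inter> A"] by metis
  then show ?thesis using that by blast
qed

text \<open>Two unbounded pieces of \<open>A\<close> could replace it in \<open>P\<close> and give a
  larger family.\<close>

lemma part_atom:
  assumes A: "A \<in> P" and V: "clopen V"
  shows "A \<inter> V \<in> Bn \<or> A - V \<in> Bn"
proof (rule ccontr)
  assume n: "\<not> (A \<inter> V \<in> Bn \<or> A - V \<in> Bn)"
  have l: "large (A \<inter> V)" "large (A - V)"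
    using n clopen_Int[OF part_clopen[OF A] V] clopen_Diff[OF part_clopen[OF A] V]
    by (simp_all add: large_def)
  have ne: "A \<inter> V \<noteq> {}" "A - V \<noteq> {}" using n bounded_empty by metis+
  have dj: "A \<inter> B = {}" if "B \<in> P - {A}" for B using part_disjoint A that by blast
  let ?Q = "insert (A \<inter> V) (insert (A - V) (P - {A}))"
  have nin: "A \<inter> V \<notin> insert (A - V) (P - {A})" "A - V \<notin> P - {A}"
    using ne dj by blast+
  have "pairwise disjnt (P - {A})"
    using family unfolding family_def by (auto intro: pairwise_subset)
  then have "pairwise disjnt ?Q"
    using dj by (fastforce simp: pairwise_insert disjnt_def)
  then have "family ?Q"
    using l part_large fin by (simp add: family_def)
  moreover have "card ?Q = Suc (card P)"
  proof -
    have "card ?Q = Suc (Suc (card (P - {A})))" using nin fin by simp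
    also have "Suc (card (P - {A})) = card P" using fin A by (rule card_Suc_Diff1)
    finally show ?thesis .
  qed
  ultimately show False using max by fastforce
qed

lemma translate_atom:
  assumes A: "A \<in> P" and V: "clopen V" and g: "g \<in> carrier G"
  shows "(g <# A) \<inter> V \<in> Bn \<or> (g <# A) - V \<in> Bn"
proof -
  define V' where "V' = inv g <# V"
  have V': "x \<in> V' \<longleftrightarrow> g \<otimes> x \<in> V" if "x \<in> carrier G" for x
    unfolding V'_def using mem_translate_iff[of "inv g" V x] g clopen_sub[OF V] that by simp
  have aG: "a \<in> carrier G" if "a \<in> A" for a using that part_sub[OF A] by blast
  have "clopen V'" unfolding V'_def using g V by (simp add: clopen_translate)
  then have "A \<inter> V' \<in> Bn \<or> A - V' \<in> Bn" by (rule part_atom[OF A])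
  then have "g <# (A \<inter> V') \<in> Bn \<or> g <# (A - V') \<in> Bn"
    using bounded_translate[OF g] by blast
  moreover have "(g <# A) \<inter> V \<subseteq> g <# (A \<inter> V')" "(g <# A) - V \<subseteq> g <# (A - V')"
    using V' aG by (auto simp: l_coset_def)
  ultimately show ?thesis using bounded_subset by blast
qed

section \<open>Cosets and balls that miss the frontier of the partition\<close>

definition frontier :: "'a set \<Rightarrow> 'a set" where
  "frontier K = (\<Union>A\<in>P. bd K A)"

lemma frontier_bounded: "K \<in> Bn \<Longrightarrow> frontier K \<in> Bn"
  unfolding frontier_def using fin part_clopen clopen_bd by (simp add: bounded_UN)

lemma part_step: "A \<in> P \<Longrightarrow> x \<in> A \<Longrightarrow> x \<notin> frontier K \<Longrightarrow> k \<in> K \<Longrightarrow> x \<otimes> k \<in> A"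
  unfolding frontier_def bd_def by blast

text \<open>Elements of the coset are joined to \<open>x\<close> by steps from \<open>K\<close>, and
  off the frontier no step changes the part.\<close>

lemma coset_in_part:
  assumes K: "K \<in> Bn" "set_inv K = K" and A: "A \<in> P" "x \<in> A"
    and off: "(x <# generate G K) \<inter> frontier K = {}"
  shows "x <# generate G K \<subseteq> A"
proof
  have KG: "K \<subseteq> carrier G" using bounded_carrier K by simp
  have xG: "x \<in> carrier G" using A part_sub by blast
  \<comment> \<open>The coset is built into \<open>?W\<close> because only its points are known to
    miss the frontier.\<close>
  let ?W = "A \<inter> (x <# generate G K)"
  have W: "?W \<subseteq> carrier G" using part_sub A by blast
  have step: "y \<otimes> k \<in> ?W" if yk: "y \<in> ?W" "k \<in> K" for y k
  proof
    show "y \<otimes> k \<in> A" using yk off part_step A(1) by blast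
    obtain h where h: "h \<in> generate G K" "y = x \<otimes> h"
      using yk(1) by (auto simp: l_coset_def)
    have "h \<otimes> k \<in> generate G K" using h yk(2) by (simp add: generate.eng generate.incl)
    moreover have "y \<otimes> k = x \<otimes> (h \<otimes> k)"
      using h yk(2) xG KG generate_in_carrier[OF KG h(1)] by (simp add: m_assoc subset_iff)
    ultimately show "y \<otimes> k \<in> x <# generate G K" by (auto simp: l_coset_def)
  qed
  have "x \<otimes> \<one> \<in> x <# generate G K" unfolding l_coset_def using generate.one by blast
  then have xW: "x \<in> ?W" using A xG by simp
  fix z assume "z \<in> x <# generate G K"
  then obtain h where h: "h \<in> generate G K" "z = x \<otimes> h" by (auto simp: l_coset_def)
  have "x \<otimes> h \<in> ?W"
    by (rule generate_closed[OF W KG K(2) _ h(1) xW]) (rule step)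
  then show "z \<in> A" using h by simp
qed

text \<open>The ball of radius \<open>Suc n\<close> about \<open>g\<close> consists of the balls of
  radius \<open>n\<close> about the points \<open>g \<otimes> k\<close>, so the induction runs over
  arbitrary \<open>g\<close>. \<open>\<one> \<in> K\<close> puts \<open>g\<close> itself in the
  ball, hence off the frontier.\<close>

lemma ball_in_part:
  assumes K: "K \<subseteq> carrier G" "\<one> \<in> K" and A: "A \<in> P"
  shows "g \<in> A \<Longrightarrow> (g <# set_pow G K n) \<inter> frontier K = {} \<Longrightarrow> g <# set_pow G K n \<subseteq> A"
proof (induction n arbitrary: g)
  case 0
  then have "g \<in> carrier G" using part_sub[OF A] by blast
  then show ?case using 0 by (auto simp: l_coset_def)
next
  case (Suc n)
  have gG: "g \<in> carrier G" using Suc.prems part_sub[OF A] by blast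
  have sp: "set_pow G K n \<subseteq> carrier G"
    using K(1) by (induction n) (simp_all add: set_mult_closed)
  have assoc: "g \<otimes> (k \<otimes> s) = (g \<otimes> k) \<otimes> s" if "k \<in> K" "s \<in> set_pow G K n" for k s
    using that gG K(1) sp by (simp add: m_assoc subset_iff)
  have inball: "(g \<otimes> k) <# set_pow G K n \<subseteq> g <# set_pow G K (Suc n)" if "k \<in> K" for k
  proof
    fix y assume "y \<in> (g \<otimes> k) <# set_pow G K n"
    then obtain s where s: "s \<in> set_pow G K n" "y = (g \<otimes> k) \<otimes> s" by (auto simp: l_coset_def)
    then have "y = g \<otimes> (k \<otimes> s)" using assoc that by simp
    then show "y \<in> g <# set_pow G K (Suc n)"
      using s that by (auto simp: l_coset_def set_mult_def)
  qed
  have "g \<otimes> \<one> \<in> g <# set_pow G K (Suc n)"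
    unfolding l_coset_def using one_in_set_pow[OF K(2), of "Suc n"] by blast
  then have "g \<notin> frontier K" using Suc.prems(2) gG by auto
  then have gk: "g \<otimes> k \<in> A" if "k \<in> K" for k using part_step[OF A Suc.prems(1)] that by blast
  show ?case
  proof
    fix y assume "y \<in> g <# set_pow G K (Suc n)"
    then obtain k s where ks: "k \<in> K" "s \<in> set_pow G K n" "y = g \<otimes> (k \<otimes> s)"
      by (auto simp: l_coset_def set_mult_def)
    have "(g \<otimes> k) <# set_pow G K n \<subseteq> A"
      using Suc.IH[OF gk[OF ks(1)]] inball[OF ks(1)] Suc.prems(2) by blast
    moreover have "y \<in> (g \<otimes> k) <# set_pow G K n"
      using ks assoc by (auto simp: l_coset_def)
    ultimately show "y \<in> A" by blast
  qed
qed

section \<open>The coarsely geodesic case\<close>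

lemma geodesic_card_le_two:
  assumes K: "K \<in> Bn" "set_inv K = K" "generate G K = carrier G"
    and pow: "\<And>B. B \<in> Bn \<Longrightarrow> \<exists>n. B \<subseteq> set_pow G K n"
  shows "card P \<le> 2"
proof -
  \<comment> \<open>\<open>ball_in_part\<close> asks for \<open>\<one>\<close> among the generators;
    adjoining it keeps \<open>K\<close> bounded, symmetric and generating.\<close>
  define L where "L = insert \<one> K"
  have L: "L \<in> Bn" "\<one> \<in> L" unfolding L_def using K(1) by (simp_all add: bounded_insert)
  have LG: "L \<subseteq> carrier G" using L bounded_carrier by simp
  have Linv: "set_inv L = L"
  proof -
    have "set_inv L = insert \<one> (set_inv K)" by (auto simp: L_def SET_INV_def)
    then show ?thesis using K(2) by (simp add: L_def)
  qed
  have gen: "x \<in> generate G L" if "x \<in> carrier G" for x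
    using that K(3) mono_generate[of K L] by (auto simp: L_def)
  obtain n where n: "frontier L \<subseteq> set_pow G L n"
    using pow[OF frontier_bounded[OF L(1)]] set_pow_mono[of K L] subset_insertI[of K \<one>]
    unfolding L_def by blast
  define C where "C = set_pow G L n"
  have C: "C \<in> Bn" "frontier L \<subseteq> C" unfolding C_def using L n set_pow_bounded by simp_all
  have CG: "C \<subseteq> carrier G" using C bounded_carrier by simp
  \<comment> \<open>An element \<open>g\<close> outside this set makes both \<open>g <# C\<close>
    and \<open>inv g <# C\<close> disjoint from \<open>C\<close>, hence from the frontier.\<close>
  have "C <#> set_inv C \<in> Bn" using C by (simp add: bounded_mult bounded_inv)
  then obtain g where g: "g \<in> carrier G" "g \<notin> C <#> set_inv C"
    using carrier_unbounded bounded_subset by blast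
  have sep: "g \<otimes> c \<noteq> d" if cd: "c \<in> C" "d \<in> C" for c d
  proof
    assume "g \<otimes> c = d"
    moreover have "c \<in> carrier G" using cd CG by blast
    ultimately have "g = d \<otimes> inv c" using g(1) inv_solve_right by (metis m_closed)
    then show False using g(2) cd by (auto simp: set_mult_def SET_INV_def)
  qed
  have sep': "inv g \<otimes> c \<noteq> d" if cd: "c \<in> C" "d \<in> C" for c d
  proof
    assume "inv g \<otimes> c = d"
    then have "g \<otimes> d = g \<otimes> (inv g \<otimes> c)" by simp
    also have "\<dots> = c" using g(1) cd CG by (simp add: m_assoc[symmetric] subset_iff)
    finally show False using sep cd by blast
  qed
  \<comment> \<open>\<open>A1\<close> will contain \<open>g <# C\<close>, and \<open>A2\<close> will
    contain \<open>inv g <# C\<close>, so that \<open>C\<close> lies in the translate of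
    \<open>A2\<close> by \<open>g\<close>.\<close>
  obtain A1 where A1: "A1 \<in> P" "g \<in> A1" using in_part g(1) by blast
  obtain A2 where A2: "A2 \<in> P" "inv g \<in> A2" using in_part inv_closed[OF g(1)] by blast
  have "(g <# C) \<inter> frontier L = {}" using C(2) sep by (fastforce simp: l_coset_def)
  then have gC: "g <# C \<subseteq> A1"
    unfolding C_def by (rule ball_in_part[OF LG L(2) A1])
  have "(inv g <# C) \<inter> frontier L = {}" using C(2) sep' by (fastforce simp: l_coset_def)
  then have giC: "inv g <# C \<subseteq> A2"
    unfolding C_def by (rule ball_in_part[OF LG L(2) A2])
  have dj: "A \<inter> (g <# B) = {}" if A: "A \<in> P" "A \<noteq> A1" and B: "B \<in> P" "B \<noteq> A2" for A B
  proof (rule ccontr)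
    assume "A \<inter> (g <# B) \<noteq> {}"
    then obtain y where y: "y \<in> A" "y \<in> g <# B" by blast
    define W where "W = {x \<in> A. inv g \<otimes> x \<in> B}"
    have WG: "W \<subseteq> carrier G" using part_sub[OF A(1)] by (auto simp: W_def)
    have yG: "y \<in> carrier G" using y part_sub[OF A(1)] by blast
    have yW: "y \<in> W"
      using y mem_translate_iff[OF g(1) part_sub[OF B(1)] yG] by (simp add: W_def)
    have step: "x \<otimes> k \<in> W" if x: "x \<in> W" and k: "k \<in> L" for x k
    proof -
      have G: "x \<in> carrier G" "k \<in> carrier G" using x k WG LG by auto
      have xAB: "x \<in> A" "inv g \<otimes> x \<in> B" using x by (auto simp: W_def)
      \<comment> \<open>\<open>B \<noteq> A2\<close> keeps \<open>x\<close> out of \<open>C\<close>,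
        and below \<open>A \<noteq> A1\<close> keeps \<open>inv g \<otimes> x\<close> out of
        \<open>C\<close>. Neither point is then on the frontier, so a step by \<open>k\<close>
        changes neither part.\<close>
      have "x \<notin> C"
      proof
        assume "x \<in> C"
        then have "inv g \<otimes> x \<in> A2" using giC by (auto simp: l_coset_def)
        then show False using part_disjoint[OF B(1) A2(1) B(2)] xAB by blast
      qed
      then have 1: "x \<otimes> k \<in> A" using part_step[OF A(1) xAB(1) _ k] C(2) by blast
      have "inv g \<otimes> x \<notin> C"
      proof
        assume "inv g \<otimes> x \<in> C"
        then have "x \<in> g <# C" using mem_translate_iff[OF g(1) CG G(1)] by simp
        then show False using gC part_disjoint[OF A(1) A1(1) A(2)] xAB by blast
      qed
      then have "(inv g \<otimes> x) \<otimes> k \<in> B" using part_step[OF B(1) xAB(2) _ k] C(2) by blast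
      then have "inv g \<otimes> (x \<otimes> k) \<in> B" using G g(1) by (simp add: m_assoc)
      then show ?thesis using 1 by (simp add: W_def)
    qed
    \<comment> \<open>As \<open>L\<close> generates the whole group, the closed set \<open>W\<close>
      would contain even \<open>g\<close>, which lies in \<open>A1\<close> and not in
      \<open>A\<close>.\<close>
    have "y \<otimes> (inv y \<otimes> g) \<in> W"
      by (rule generate_closed[OF WG LG Linv _ gen yW]) (use step yG g(1) in auto)
    moreover have "y \<otimes> (inv y \<otimes> g) = g" using yG g(1) by (simp add: m_assoc[symmetric])
    ultimately have "g \<in> A" by (simp add: W_def)
    then show False using A1 A part_disjoint by blast
  qed
  define Q1 where "Q1 = P - {A1}"
  define Q2 where "Q2 = (\<lambda>B. g <# B) ` (P - {A2})"
  have inj: "inj_on (\<lambda>B. g <# B) P"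
    by (rule inj_on_inverseI[where g = "\<lambda>B. inv g <# B"]) (simp add: translate_inverse g(1) part_sub)
  have l2: "large (g <# B)" if "B \<in> P" for B
    using that g(1) part_large part_sub
    by (simp add: large_def clopen_translate bounded_translate_iff)
  have dj2: "(g <# B) \<inter> (g <# B') = {}" if "B \<in> P" "B' \<in> P" "B \<noteq> B'" for B B'
  proof (rule ccontr)
    assume "(g <# B) \<inter> (g <# B') \<noteq> {}"
    then obtain x where x: "x \<in> g <# B" "x \<in> g <# B'" by blast
    have xG: "x \<in> carrier G" using x(1) translate_sub[OF g(1) part_sub[OF that(1)]] by blast
    show False
      using x mem_translate_iff[OF g(1) part_sub xG] that part_disjoint by blast
  qed
  have cross: "disjnt S T" "disjnt T S" if "S \<in> Q1" "T \<in> Q2" for S T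
    using that dj by (auto simp: Q1_def Q2_def disjnt_def)
  have "pairwise disjnt (Q1 \<union> Q2)"
  proof (rule pairwiseI)
    fix S T assume ST: "S \<in> Q1 \<union> Q2" "T \<in> Q1 \<union> Q2" "S \<noteq> T"
    have "disjnt S T" if "S \<in> Q1" "T \<in> Q1"
      using that ST(3) part_disjoint by (simp add: Q1_def disjnt_def)
    moreover have "disjnt S T" if "S \<in> Q2" "T \<in> Q2"
      using that ST(3) dj2 unfolding Q2_def disjnt_def by blast
    ultimately show "disjnt S T" using ST cross by blast
  qed
  moreover have "\<forall>A\<in>Q1 \<union> Q2. large A"
    using l2 part_large by (auto simp: Q1_def Q2_def)
  ultimately have "family (Q1 \<union> Q2)"
    using fin by (simp add: family_def Q1_def Q2_def)
  then have le: "card (Q1 \<union> Q2) \<le> card P" by (rule max)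
  \<comment> \<open>A common member would be disjoint from itself, hence empty.\<close>
  have "Q1 \<inter> Q2 = {}"
  proof (rule ccontr)
    assume "Q1 \<inter> Q2 \<noteq> {}"
    then obtain S where S: "S \<in> Q1" "S \<in> Q2" by blast
    then have "S = {}" using cross by (metis disjnt_self_iff_empty)
    then show False using S(1) part_nonempty by (auto simp: Q1_def)
  qed
  then have "card (Q1 \<union> Q2) = card Q1 + card Q2"
    using fin by (intro card_Un_disjoint) (simp_all add: Q1_def Q2_def)
  also have "card Q2 = card (P - {A2})"
    unfolding Q2_def by (rule card_image) (rule inj_on_subset[OF inj], blast)
  \<comment> \<open>With \<open>N = card P\<close>, the bound reads
    \<open>2 * (N - 1) \<le> N\<close>.\<close>
  finally show ?thesis
    using le A1 A2 fin by (simp add: Q1_def)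
qed

section \<open>Exhaustion by proper boundedly generated subgroups\<close>

abbreviation bg :: "'a set \<Rightarrow> bool" where
  "bg \<equiv> boundedly_generated G Bn"

text \<open>A far coset \<open>x <# H\<close> lies in one part \<open>A\<close>, so \<open>H\<close>
  lies in \<open>inv x <# A\<close>. This translate is again an atom modulo bounded sets, so it is
  almost contained in a single part.\<close>

lemma bg_almost_in_part:
  assumes exh: "\<And>B. B \<in> Bn \<Longrightarrow> \<exists>H. bg H \<and> B \<subseteq> H"
    and proper: "\<And>H. bg H \<Longrightarrow> H \<noteq> carrier G"
    and H: "bg H"
  obtains A where "A \<in> P" "H - A \<in> Bn"
proof -
  obtain K where K: "K \<in> Bn" "set_inv K = K" "generate G K = H"
    using H by (auto simp: boundedly_generated_def)
  \<comment> \<open>\<open>H'\<close> contains \<open>H\<close> as well as the frontier, so cosets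
    of \<open>H\<close> through points outside \<open>H'\<close> miss the frontier.\<close>
  obtain H' where H': "bg H'" "K \<union> frontier K \<subseteq> H'"
    using exh[OF bounded_Un[OF K(1) frontier_bounded[OF K(1)]]] by blast
  have sg: "subgroup H' G" using H'(1) by (simp add: boundedly_generated_def)
  have HH': "H \<subseteq> H'" using generate_subgroup_incl[OF _ sg, of K] H'(2) K(3) by blast
  obtain x where x: "x \<in> carrier G" "x \<notin> H'"
    using proper[OF H'(1)] subgroup.subset[OF sg] by blast
  obtain A where A: "A \<in> P" "x \<in> A" using in_part x(1) by blast
  have "x <# H \<subseteq> A"
    using coset_in_part[OF K(1,2) A] coset_off_subgroup[OF sg HH' x, of "frontier K"] H'(2) K(3)
    by simp
  have HA: "H \<subseteq> inv x <# A"
  proof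
    fix h assume h: "h \<in> H"
    then have hG: "h \<in> carrier G" using HH' subgroup.subset[OF sg] by blast
    have "x \<otimes> h \<in> A" using h \<open>x <# H \<subseteq> A\<close> by (auto simp: l_coset_def)
    then show "h \<in> inv x <# A"
      using mem_translate_iff[OF inv_closed[OF x(1)] part_sub[OF A(1)] hG] x(1) by simp
  qed
  have ix: "inv x \<in> carrier G" using x(1) by simp
  have "inv x <# A \<notin> Bn"
    using bounded_translate_iff[OF ix part_sub[OF A(1)]] part_unbounded[OF A(1)] by simp
  then obtain A' where A': "A' \<in> P" "(inv x <# A) \<inter> A' \<notin> Bn"
    using unbounded_meets_part[OF translate_sub[OF ix part_sub[OF A(1)]]] by blast
  then have "(inv x <# A) - A' \<in> Bn" using translate_atom[OF A(1) part_clopen[OF A'(1)] ix] by blast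
  then have "H - A' \<in> Bn" by (rule bounded_subset) (use HA in blast)
  then show ?thesis using that A'(1) by blast
qed

text \<open>For unbounded \<open>H\<close>, the part \<open>A0\<close> almost containing
  \<open>H\<close> also almost contains every larger boundedly generated \<open>J\<close>, and
  cosets of \<open>H\<close> off a suitable \<open>H'\<close> lie entirely in it. All other parts
  are then squeezed into the bounded set \<open>H' - A0\<close>.\<close>

lemma not_boundedly_generated:
  assumes exh: "\<And>B. B \<in> Bn \<Longrightarrow> \<exists>H. bg H \<and> B \<subseteq> H"
    and proper: "\<And>H. bg H \<Longrightarrow> H \<noteq> carrier G"
    and H: "bg H"
  shows "H \<in> Bn"
proof (rule ccontr)
  assume unb: "H \<notin> Bn"
  obtain K where K: "K \<in> Bn" "set_inv K = K" "generate G K = H"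
    using H by (auto simp: boundedly_generated_def)
  have HG: "H \<subseteq> carrier G"
    using H subgroup.subset by (auto simp: boundedly_generated_def)
  obtain A0 where A0: "A0 \<in> P" "H - A0 \<in> Bn"
    using bg_almost_in_part[OF exh proper H] by blast
  have bgsub: "subgroup J G" "K \<subseteq> J \<Longrightarrow> H \<subseteq> J" if "bg J" for J
  proof -
    show "subgroup J G" using that by (simp add: boundedly_generated_def)
    then show "K \<subseteq> J \<Longrightarrow> H \<subseteq> J" using generate_subgroup_incl[of K J] K(3) by simp
  qed
  have all: "J - A0 \<in> Bn" if J: "bg J" "H \<subseteq> J" for J
  proof -
    obtain A where A: "A \<in> P" "J - A \<in> Bn"
      using bg_almost_in_part[OF exh proper J(1)] by blast
    have "A = A0"
    proof (rule ccontr)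
      assume "A \<noteq> A0"
      then have "H \<subseteq> (J - A) \<union> (H - A0)" using part_disjoint[OF A(1) A0(1)] J(2) by blast
      then show False using unb bounded_subset[OF bounded_Un[OF A(2) A0(2)]] by blast
    qed
    then show ?thesis using A by simp
  qed
  obtain H' where H': "bg H'" "K \<union> frontier K \<subseteq> H'"
    using exh[OF bounded_Un[OF K(1) frontier_bounded[OF K(1)]]] by blast
  have HH': "H \<subseteq> H'" using bgsub(2)[OF H'(1)] H'(2) by blast
  have out: "x \<in> A0" if x: "x \<in> carrier G" "x \<notin> H'" for x
  proof -
    obtain A where A: "A \<in> P" "x \<in> A" using in_part x(1) by blast
    have xHA: "x <# H \<subseteq> A"
      using coset_in_part[OF K(1,2) A] coset_off_subgroup[OF bgsub(1)[OF H'(1)] HH' x, of "frontier K"]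
        H'(2) K(3) by simp
    \<comment> \<open>\<open>J\<close> depends on \<open>x\<close>: it contains the coset
      \<open>x <# H\<close>, which is unbounded and so does not fit into
      \<open>J - A0\<close>.\<close>
    obtain J where J: "bg J" "insert x K \<subseteq> J" using exh[OF bounded_insert[OF x(1) K(1)]] by blast
    have HJ: "H \<subseteq> J" using bgsub(2)[OF J(1)] J(2) by blast
    have xHJ: "x <# H \<subseteq> J"
      using subgroup.m_closed[OF bgsub(1)[OF J(1)]] J(2) HJ by (auto simp: l_coset_def)
    have "A = A0"
    proof (rule ccontr)
      assume "A \<noteq> A0"
      then have "x <# H \<subseteq> J - A0" using xHA xHJ part_disjoint[OF A(1) A0(1)] by blast
      then have "x <# H \<in> Bn" using all[OF J(1) HJ] bounded_subset by blast
      then show False using unb bounded_translate_iff[OF x(1) HG] by simp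
    qed
    then show ?thesis using A by simp
  qed
  obtain B where B: "B \<in> P" "B \<noteq> A0" by (rule other_part)
  have "B \<subseteq> H' - A0" using out part_sub[OF B(1)] part_disjoint[OF B(1) A0(1) B(2)] by blast
  then show False using all[OF H'(1) HH'] part_unbounded[OF B(1)] bounded_subset by blast
qed

section \<open>Exhaustion by bounded subgroups\<close>

lemma no_bounded_exhaustion:
  assumes sg: "\<And>n :: nat. subgroup (R n) G" and bdd: "\<And>n. R n \<in> Bn"
    and exh: "\<And>B. B \<in> Bn \<Longrightarrow> \<exists>n. B \<subseteq> R n"
  shows False
proof -
  have next_ex: "\<exists>J. subgroup J G \<and> J \<in> Bn \<and> H \<subset> J \<and> R n \<subseteq> J" if H: "H \<in> Bn" for H n
  proof -
    obtain x where x: "x \<in> carrier G" "x \<notin> H"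
      using carrier_unbounded bounded_subset[OF H] by blast
    obtain m where "insert x (H \<union> R n) \<subseteq> R m"
      using exh[OF bounded_insert[OF x(1) bounded_Un[OF H bdd]]] by blast
    then show ?thesis using sg bdd x(2) by blast
  qed
  \<comment> \<open>The \<open>R n\<close> need not be nested. The chain \<open>H\<close> increases
    strictly, and absorbing \<open>R n\<close> at stage \<open>Suc n\<close> lets it still exhaust
    the bounded sets.\<close>
  have "\<exists>H. \<forall>n. (subgroup (H n) G \<and> H n \<in> Bn) \<and> (H n \<subset> H (Suc n) \<and> R n \<subseteq> H (Suc n))"
  proof (rule dependent_nat_choice[where P = "\<lambda>_ J. subgroup J G \<and> J \<in> Bn"
        and Q = "\<lambda>n H J. H \<subset> J \<and> R n \<subseteq> J"])
    show "\<exists>J. subgroup J G \<and> J \<in> Bn" using sg[of 0] bdd[of 0] by blast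
    fix J n assume "subgroup J G \<and> J \<in> Bn"
    then show "\<exists>J'. (subgroup J' G \<and> J' \<in> Bn) \<and> J \<subset> J' \<and> R n \<subseteq> J'"
      using next_ex[of J n] by (elim conjE) simp
  qed
  then obtain H where H0:
    "\<forall>n. (subgroup (H n) G \<and> H n \<in> Bn) \<and> (H n \<subset> H (Suc n) \<and> R n \<subseteq> H (Suc n))" ..
  have H: "\<And>n. subgroup (H n) G" "\<And>n. H n \<in> Bn"
    "\<And>n. H n \<subset> H (Suc n)" "\<And>n. R n \<subseteq> H (Suc n)"
    using H0 by simp_all
  have mono: "H m \<subseteq> H n" if "m \<le> n" for m n
    by (rule lift_Suc_mono_le[of H, OF psubset_imp_subset[OF H(3)] that])
  have exh': "\<exists>m. B \<subseteq> H m" if "B \<in> Bn" for B using exh[OF that] H(4) by blast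
  define U where "U S = (\<Union>k\<in>S. H (Suc k) - H k)" for S
  have index: "k = l" if "x \<in> H (Suc k) - H k" "x \<in> H (Suc l) - H l" for x k l
  proof (rule ccontr)
    assume "k \<noteq> l"
    then consider "Suc k \<le> l" | "Suc l \<le> k" by linarith
    then show False using that mono by cases blast+
  qed
  have U_clopen: "clopen (U S)" for S
    unfolding clopen_iff_bd
  proof (intro conjI ballI)
    show "U S \<subseteq> carrier G" using subgroup.subset[OF H(1)] by (auto simp: U_def)
    fix B assume B: "B \<in> Bn"
    obtain m where m: "B \<subseteq> H m" using exh'[OF B] by blast
    \<comment> \<open>Right multiplication by an element of \<open>H m\<close> preserves every layer
      with index \<open>k \<ge> m\<close>, so only points of \<open>H m\<close> can leave
      \<open>U S\<close> by a step from \<open>B\<close>.\<close>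
    have "bd B (U S) \<subseteq> H m"
    proof (rule subsetI, rule ccontr)
      fix x assume x: "x \<in> bd B (U S)" "x \<notin> H m"
      then obtain b k where b: "b \<in> B" "x \<otimes> b \<notin> U S" and k: "k \<in> S" "x \<in> H (Suc k)" "x \<notin> H k"
        by (auto simp: bd_def U_def)
      have "m \<le> k" using mono[of "Suc k" m] k(2) x(2) not_less_eq_eq[of m k] by blast
      then have bk: "b \<in> H k" using b(1) m mono by blast
      have bk': "b \<in> H (Suc k)" using bk H(3)[of k] by blast
      have G: "x \<in> carrier G" "b \<in> carrier G"
        using subgroup.mem_carrier[OF H(1)] k(2) bk by blast+
      have 1: "x \<otimes> b \<in> H (Suc k)" using subgroup.m_closed[OF H(1) k(2) bk'] .
      have "x \<otimes> b \<notin> H k"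
      proof
        assume "x \<otimes> b \<in> H k"
        then have "x \<otimes> b \<otimes> inv b \<in> H k"
          using subgroup.m_closed[OF H(1)] subgroup.m_inv_closed[OF H(1) bk] by blast
        then show False using G k(3) by (simp add: m_assoc)
      qed
      then show False using 1 b(2) k(1) by (auto simp: U_def)
    qed
    then show "bd B (U S) \<in> Bn" using bounded_subset[OF H(2)] by blast
  qed
  \<comment> \<open>The condition says that \<open>S\<close> is infinite. Layers are nonempty by
    strictness, so those of large index escape every \<open>H m\<close>.\<close>
  have U_unb: "U S \<notin> Bn" if S: "\<And>m. \<exists>k\<in>S. m \<le> k" for S
  proof
    assume "U S \<in> Bn"
    then obtain m where m: "U S \<subseteq> H m" using exh' by blast
    obtain k where k: "k \<in> S" "m \<le> k" using S by blast
    obtain x where x: "x \<in> H (Suc k)" "x \<notin> H k" using H(3)[of k] by blast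
    then have "x \<in> H m" using m k(1) by (auto simp: U_def)
    then show False using x(2) mono[OF k(2)] by blast
  qed
  \<comment> \<open>Residue classes modulo \<open>N\<close> split the layers into one more large set
    than \<open>P\<close> has members.\<close>
  define N where "N = Suc (card P)"
  define f where "f r = U {k. k mod N = r}" for r
  have f_large: "large (f r)" if "r < N" for r
  proof -
    have "\<exists>k\<in>{k. k mod N = r}. m \<le> k" for m
    proof
      show "r + N * m \<in> {k. k mod N = r}" using that by simp
      show "m \<le> r + N * m" by (simp add: N_def)
    qed
    then show ?thesis unfolding f_def large_def using U_clopen U_unb by blast
  qed
  have f_dj: "f r \<inter> f s = {}" if "r \<noteq> s" for r s
  proof (rule ccontr)
    assume "f r \<inter> f s \<noteq> {}"
    then obtain x where "x \<in> f r" "x \<in> f s" by blast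
    then obtain k l where kl: "x \<in> H (Suc k) - H k" "k mod N = r"
      "x \<in> H (Suc l) - H l" "l mod N = s"
      unfolding f_def U_def by blast
    show False using index[OF kl(1,3)] kl(2,4) that by simp
  qed
  have f_ne: "f r \<noteq> {}" if "r < N" for r
    using f_large[OF that] bounded_empty by (auto simp: large_def)
  have "inj_on f {..<N}"
  proof (rule inj_onI, rule ccontr)
    fix r s assume "r \<in> {..<N}" "s \<in> {..<N}" "f r = f s" "r \<noteq> s"
    then show False using f_dj[of r s] f_ne[of r] by simp
  qed
  then have "card (f ` {..<N}) = N" by (simp add: card_image)
  moreover have "family (f ` {..<N})"
    unfolding family_def
  proof (intro conjI)
    show "pairwise disjnt (f ` {..<N})"
      by (rule pairwise_imageI) (simp add: disjnt_def f_dj)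
  qed (use f_large in auto)
  ultimately show False using max[of "f ` {..<N}"] by (simp add: N_def)
qed

end

section \<open>From three ends to a maximal partition, and the combination of the cases\<close>

theorem theorem9p9:
  fixes G :: "('a, 'b) monoid_scheme" and Bn :: "'a set set" and Gs :: "nat \<Rightarrow> 'a set"
  assumes "large_scale_group G Bn"
    and "basis_bg_subgroups G Bn Gs"
    and "\<forall>i\<ge>1. coarsely_geodesic_subgroup G Bn (Gs i)"
  shows "infinite (ends G Bn) \<or> card (ends G Bn) \<le> 2"
proof (rule ccontr)
  assume n: "\<not> (infinite (ends G Bn) \<or> card (ends G Bn) \<le> 2)"
  then have fin: "finite (ends G Bn)" and c3: "3 \<le> card (ends G Bn)" by simp_all
  have "group G" using assms(1) by (simp add: large_scale_group_def)
  then interpret ls_group G Bn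
    using assms(1) by (simp add: ls_group_def ls_group_axioms_def)
  obtain T where T: "T \<subseteq> ends G Bn" "card T = 3"
    using obtain_subset_with_card_n[OF c3] by blast
  obtain E1 E2 E3 where E: "T = {E1, E2, E3}" "E1 \<noteq> E2" "E1 \<noteq> E3" "E2 \<noteq> E3"
    using T(2) card_3_iff[of T] by metis
  obtain P0 where P0: "family P0" "card P0 = 3"
    using family_three[of E1 E2 E3] E T(1) by blast
  \<comment> \<open>A family exists by the three ends, and the finite number of ends bounds all
    cardinalities.\<close>
  have "\<exists>P. family P \<and> (\<forall>Q. family Q \<longrightarrow> card Q \<le> card P)"
  proof (rule ex_has_greatest_nat[where P = family and f = card and k = P0
        and b = "Suc (card (ends G Bn))"])
    show "\<forall>Q. family Q \<longrightarrow> card Q < Suc (card (ends G Bn))"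
      using family_card_le[OF fin] by (simp add: less_Suc_eq_le)
  qed (rule P0(1))
  then obtain P1 where P1: "family P1" "\<And>Q. family Q \<Longrightarrow> card Q \<le> card P1"
    by blast
  have c: "3 \<le> card P1" using P1(2)[OF P0(1)] P0(2) by simp
  then have "P1 \<noteq> {}" by auto
  then obtain P where P: "family P" "\<Union>P = carrier G" "card P = card P1"
    by (rule family_to_cover[OF P1(1)])
  interpret max_partition G Bn P
    by unfold_locales (use P P1(2) c in simp_all)
  have Gs_bg: "bg (Gs i)" if "1 \<le> i" for i
    using assms(2) that by (simp add: basis_bg_subgroups_def)
  have Gs_exh: "\<exists>i\<ge>1. B \<subseteq> Gs i" if "B \<in> Bn" for B
    using assms(2) that by (simp add: basis_bg_subgroups_def)
  have exh: "\<exists>H. bg H \<and> B \<subseteq> H" if "B \<in> Bn" for B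
    using Gs_exh[OF that] Gs_bg by blast
  \<comment> \<open>A basis subgroup equal to the whole group would make it coarsely geodesic,
    against the at least three members of \<open>P\<close>.\<close>
  have "Gs i \<noteq> carrier G" if i: "1 \<le> i" for i
  proof
    assume eq: "Gs i = carrier G"
    have "coarsely_geodesic_subgroup G Bn (Gs i)" using assms(3) i by blast
    then obtain K where K: "K \<in> Bn" "set_inv\<^bsub>G\<^esub> K = K" "generate G K = carrier G"
      and pow: "\<forall>B\<in>induced_bornology Bn (carrier G). \<exists>n\<ge>1. B \<subseteq> set_pow G K n"
      unfolding coarsely_geodesic_subgroup_def eq by (auto simp: induced_bornology_def)
    have "\<exists>n. B \<subseteq> set_pow G K n" if "B \<in> Bn" for B
    proof -
      have "B \<in> induced_bornology Bn (carrier G)"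
        using that bounded_carrier by (simp add: induced_bornology_def)
      then show ?thesis using pow by blast
    qed
    then have "card P \<le> 2" by (rule geodesic_card_le_two[OF K])
    then show False using P(3) c by simp
  qed
  \<comment> \<open>A bounded generating set of \<open>H\<close> lies in some \<open>Gs i\<close>,
    and so does \<open>H\<close>; properness therefore passes from the basis to
    \<open>H\<close>.\<close>
  then have proper: "H \<noteq> carrier G" if H: "bg H" for H
  proof -
    obtain K where K: "K \<in> Bn" "generate G K = H"
      using H by (auto simp: boundedly_generated_def)
    obtain i where i: "1 \<le> i" "K \<subseteq> Gs i" using Gs_exh[OF K(1)] by blast
    have sg: "subgroup (Gs i) G" using Gs_bg[OF i(1)] by (simp add: boundedly_generated_def)
    have "H \<subseteq> Gs i" using generate_subgroup_incl[OF i(2) sg] K(2) by simp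
    then show ?thesis
      using subgroup.subset[OF sg] \<open>\<And>i. 1 \<le> i \<Longrightarrow> Gs i \<noteq> carrier G\<close>[OF i(1)] by blast
  qed
  show False
  \<comment> \<open>\<open>Suc\<close> shifts the index because the basis starts at
    \<open>1\<close>.\<close>
  proof (rule no_bounded_exhaustion[of "\<lambda>n. Gs (Suc n)"])
    fix n
    show "subgroup (Gs (Suc n)) G" using Gs_bg[of "Suc n"] by (simp add: boundedly_generated_def)
    show "Gs (Suc n) \<in> Bn" using not_boundedly_generated[OF exh proper] Gs_bg[of "Suc n"] by simp
  next
    fix B assume "B \<in> Bn"
    then obtain i where "1 \<le> i" "B \<subseteq> Gs i" using Gs_exh by blast
    then show "\<exists>n. B \<subseteq> Gs (Suc n)" by (intro exI[of _ "i - 1"]) simp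
  qed
qed

end
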